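(* Assume that the space decomposition $\mathcal K=\sum_{i=1}^N\mathcal K_i$ satisfies the following two assumptions with positive constants $C_A$ and $C_S$. (SD) For every $v\in\mathcal K$ there exist $v_i\in\mathcal K_i$, $i=1,\dots,N$, such that $v=\sum_{i=1}^N v_i$ and $\sum_{i=1}^N\|v_i\|_A^2\le C_A\|v\|_A^2$. (SCS) For any $u_i\in\mathcal K_i$ and $v_j\in\mathcal K_j$ ($i,j=1,\dots,N$), $$\sum_{i=1}^N\sum_{j=i+1}^N(u_i,v_j)_A\le C_S^{1/2}\Big(\sum_{i=1}^N\|u_i\|_A^2\Big)^{1/2}\Big(\sum_{j=1}^N\|v_j\|_A^2\Big)^{1/2}.$$ Let $u$ be the minimizer of $E$ over $\mathcal K$, let $u^k\in\mathcal K$, and let $u^{k+1}=\mathrm{SSO}(u^k)$ be obtained by one step of the successive subspace optimization method. Then $$E(u^{k+1})-E(u)\le\Big(1-\frac{1}{1+C_AC_S}\Big)\big[E(u^k)-E(u)\big].$$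
   Context: $\mathcal H$ is a (real) Hilbert space with inner product $(\cdot,\cdot)$, $\mathcal V\subset\mathcal H$ is a closed subspace, and $A:\mathcal V\to\mathcal V$ is symmetric and positive definite with respect to $(\cdot,\cdot)$; $(u,v)_A:=(Au,v)$ and $\|\cdot\|_A$ is the associated norm. $\mathcal P$ is another Hilbert space, $B:\mathcal V\to\mathcal P$ is a bounded linear operator, and $\mathcal K=\ker(B)$. For a fixed $f\in\mathcal H$, $E(v)=\frac12\|v\|_A^2-(f,v)$ for $v\in\mathcal V$. $\mathcal V=\mathcal V_1+\dots+\mathcal V_N$ with subspaces $\mathcal V_i\subset\mathcal V$, and $\mathcal K_i=\mathcal V_i\cap\ker(B)$ are assumed to satisfy $\mathcal K=\mathcal K_1+\dots+\mathcal K_N$. The saddle point problem associated with minimizing $E$ over $\mathcal K$ is assumed well posed; the minimizer of $E$ over $\mathcal K$ and the minimizers of the local problems below exist and are unique. One step of the successive subspace optimization (SSO) method, with exact local solvers: given $u^k\in\mathcal K$, set $v_0=u^k$; for $i=1,\dots,N$ let $e_i\in\mathcal K_i$ be the minimizer of $E(v_{i-1}+e)$ over $e\in\mathcal K_i$ (equivalently $(Ae_i,\phi_i)=(f-Av_{i-1},\phi_i)$ for all $\phi_i\in\mathcal K_i$) and set $v_i=v_{i-1}+e_i$; finally $u^{k+1}=\mathrm{SSO}(u^k):=v_N$. *)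

theory Defs
  imports "HOL-Analysis.Analysis" "HOL-Library.Set_Algebras"
begin

text \<open>
  The operators of interest act on a subspace \<open>V\<close> of the ambient Hilbert space. They are modelled
  by total functions whose values outside \<open>V\<close> are irrelevant, so all properties are relative to \<open>V\<close>.
\<close>

definition linear_on_subspace :: "'a::real_vector set \<Rightarrow> ('a \<Rightarrow> 'b::real_vector) \<Rightarrow> bool" where
  "linear_on_subspace V L \<longleftrightarrow>
     (\<forall>x\<in>V. \<forall>y\<in>V. L (x + y) = L x + L y) \<and> (\<forall>c. \<forall>x\<in>V. L (c *\<^sub>R x) = c *\<^sub>R L x)"

definition bounded_linear_on_subspace ::
    "'a::real_normed_vector set \<Rightarrow> ('a \<Rightarrow> 'b::real_normed_vector) \<Rightarrow> bool" where
  "bounded_linear_on_subspace V L \<longleftrightarrow>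
     linear_on_subspace V L \<and> (\<exists>c. \<forall>x\<in>V. norm (L x) \<le> c * norm x)"

definition spd_on :: "'h::real_inner set \<Rightarrow> ('h \<Rightarrow> 'h) \<Rightarrow> bool" where
  "spd_on V A \<longleftrightarrow>
     A ` V \<subseteq> V \<and> linear_on_subspace V A \<and>
     (\<forall>x\<in>V. \<forall>y\<in>V. A x \<bullet> y = x \<bullet> A y) \<and> (\<forall>x\<in>V. x \<noteq> 0 \<longrightarrow> 0 < A x \<bullet> x)"

definition ker_on :: "'h set \<Rightarrow> ('h \<Rightarrow> 'p::zero) \<Rightarrow> 'h set" where
  "ker_on V B = {v \<in> V. B v = 0}"

definition inner_A :: "('h::real_inner \<Rightarrow> 'h) \<Rightarrow> 'h \<Rightarrow> 'h \<Rightarrow> real" where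
  "inner_A A u v = A u \<bullet> v"

definition norm_A :: "('h::real_inner \<Rightarrow> 'h) \<Rightarrow> 'h \<Rightarrow> real" where
  "norm_A A v = sqrt (inner_A A v v)"

definition energy :: "('h::real_inner \<Rightarrow> 'h) \<Rightarrow> 'h \<Rightarrow> 'h \<Rightarrow> real" where
  "energy A f v = 1 / 2 * (norm_A A v)\<^sup>2 - f \<bullet> v"

text \<open>
  The first-order (Lagrange multiplier) system of the minimization of \<open>energy A g\<close> over the kernel
  of \<open>B\<close>. Well-posedness is meant in the sense of Hadamard with respect to the datum \<open>g\<close>.
\<close>

definition saddle_point_solution ::
    "'h::real_inner set \<Rightarrow> ('h \<Rightarrow> 'h) \<Rightarrow> ('h \<Rightarrow> 'p::real_inner) \<Rightarrow> 'h \<Rightarrow> 'h \<Rightarrow> 'p \<Rightarrow> bool" where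
  "saddle_point_solution V A B g u p \<longleftrightarrow>
     u \<in> V \<and> (\<forall>w\<in>V. A u \<bullet> w + p \<bullet> B w = g \<bullet> w) \<and> (\<forall>q. q \<bullet> B u = 0)"

definition saddle_point_well_posed ::
    "'h::real_inner set \<Rightarrow> ('h \<Rightarrow> 'h) \<Rightarrow> ('h \<Rightarrow> 'p::real_inner) \<Rightarrow> bool" where
  "saddle_point_well_posed V A B \<longleftrightarrow>
     (\<forall>g. \<exists>!z. saddle_point_solution V A B g (fst z) (snd z)) \<and>
     (\<exists>c. \<forall>g u p. saddle_point_solution V A B g u p \<longrightarrow> norm u + norm p \<le> c * norm g)"

text \<open>
  \<open>sso_iterate E K v i\<close> is the iterate \<open>v\<^sub>i\<close> of the sweep over \<open>K 1, K 2, \<dots>\<close> started at \<open>v\<^sub>0 = v\<close>.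
  Since \<^const>\<open>arg_min_on\<close> is a choice operator, the sweep is meaningful only if each local
  minimizer exists, and is determined by the data only if it is unique.
\<close>

primrec sso_iterate ::
    "('h::real_vector \<Rightarrow> real) \<Rightarrow> (nat \<Rightarrow> 'h set) \<Rightarrow> 'h \<Rightarrow> nat \<Rightarrow> 'h" where
  "sso_iterate E K v 0 = v"
| "sso_iterate E K v (Suc i) =
     sso_iterate E K v i + arg_min_on (\<lambda>e. E (sso_iterate E K v i + e)) (K (Suc i))"

definition SSO :: "('h::real_vector \<Rightarrow> real) \<Rightarrow> (nat \<Rightarrow> 'h set) \<Rightarrow> nat \<Rightarrow> 'h \<Rightarrow> 'h" where
  "SSO E K N v = sso_iterate E K v N"

definition stable_decomposition ::
    "('h::real_inner \<Rightarrow> 'h) \<Rightarrow> 'h set \<Rightarrow> (nat \<Rightarrow> 'h set) \<Rightarrow> nat \<Rightarrow> real \<Rightarrow> bool" where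
  "stable_decomposition A K Ki N C \<longleftrightarrow>
     (\<forall>v\<in>K. \<exists>w. (\<forall>i\<in>{1..N}. w i \<in> Ki i) \<and> v = (\<Sum>i=1..N. w i) \<and>
        (\<Sum>i=1..N. (norm_A A (w i))\<^sup>2) \<le> C * (norm_A A v)\<^sup>2)"

definition strengthened_cauchy_schwarz ::
    "('h::real_inner \<Rightarrow> 'h) \<Rightarrow> (nat \<Rightarrow> 'h set) \<Rightarrow> nat \<Rightarrow> real \<Rightarrow> bool" where
  "strengthened_cauchy_schwarz A Ki N C \<longleftrightarrow>
     (\<forall>u v. (\<forall>i\<in>{1..N}. u i \<in> Ki i) \<longrightarrow> (\<forall>j\<in>{1..N}. v j \<in> Ki j) \<longrightarrow>
        (\<Sum>i=1..N. \<Sum>j=i+1..N. inner_A A (u i) (v j))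
          \<le> sqrt C * sqrt (\<Sum>i=1..N. (norm_A A (u i))\<^sup>2) * sqrt (\<Sum>j=1..N. (norm_A A (v j))\<^sup>2))"

end

theory Submission
  imports Defs
begin

text \<open>
  Each corrected iterate satisfies the Euler equation on its subspace, so a full sweep lowers the
  energy by exactly \<open>1/2 \<Sum>\<^sub>i \<parallel>e\<^sub>i\<parallel>\<^sub>A\<^sup>2\<close>, while \<open>E w - E u = 1/2 \<parallel>w - u\<parallel>\<^sub>A\<^sup>2\<close> for \<open>w \<in> K\<close>. Decompose the error
  \<open>w = v\<^sub>N - u\<close> stably as \<open>\<Sum>\<^sub>i w\<^sub>i\<close>. The Euler equations give \<open>(w, w\<^sub>i)\<^sub>A = (v\<^sub>N - v\<^sub>i, w\<^sub>i)\<^sub>A = \<Sum>\<^sub>j\<^sub>>\<^sub>i (e\<^sub>j, w\<^sub>i)\<^sub>A\<close>,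
  and (SCS) with (SD) yields \<open>\<parallel>w\<parallel>\<^sub>A\<^sup>2 \<le> C\<^sub>A C\<^sub>S \<Sum>\<^sub>i \<parallel>e\<^sub>i\<parallel>\<^sub>A\<^sup>2\<close>. Thus the new energy error is at most
  \<open>C\<^sub>A C\<^sub>S\<close> times the energy decrease, which is the claimed contraction.
\<close>

lemma subspace_ker_on:
  assumes "subspace V" "linear_on_subspace V B"
  shows "subspace (ker_on V B)"
proof (rule subspaceI)
  have "B (0 *\<^sub>R 0) = 0 *\<^sub>R B 0"
    using assms unfolding linear_on_subspace_def by (meson subspace_0)
  then show "0 \<in> ker_on V B"
    using assms by (simp add: ker_on_def subspace_0)
qed (use assms in \<open>auto simp: ker_on_def linear_on_subspace_def subspace_add subspace_scale\<close>)

lemma spd_on_add: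
  "spd_on V A \<Longrightarrow> x \<in> V \<Longrightarrow> y \<in> V \<Longrightarrow> A (x + y) = A x + A y"
  by (simp add: spd_on_def linear_on_subspace_def)

lemma spd_on_scale: "spd_on V A \<Longrightarrow> x \<in> V \<Longrightarrow> A (c *\<^sub>R x) = c *\<^sub>R A x"
  by (simp add: spd_on_def linear_on_subspace_def)

lemma spd_on_zero: "spd_on V A \<Longrightarrow> subspace V \<Longrightarrow> A 0 = 0"
  using spd_on_scale[of V A 0 0] by (simp add: subspace_0)

lemma spd_on_diff:
  assumes "spd_on V A" "subspace V" "x \<in> V" "y \<in> V"
  shows "A (x - y) = A x - A y"
  using spd_on_add[OF assms(1), of "x - y" y] assms by (simp add: subspace_diff)

lemma spd_on_sum:
  assumes "spd_on V A" "subspace V" "\<And>i. i \<in> I \<Longrightarrow> g i \<in> V"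
  shows "A (\<Sum>i\<in>I. g i) = (\<Sum>i\<in>I. A (g i))"
  using assms(3)
  by (induction I rule: infinite_finite_induct)
    (simp_all add: spd_on_zero[OF assms(1,2)] spd_on_add[OF assms(1)] subspace_sum[OF assms(2)])

lemma inner_A_commute:
  "spd_on V A \<Longrightarrow> x \<in> V \<Longrightarrow> y \<in> V \<Longrightarrow> inner_A A x y = inner_A A y x"
  unfolding spd_on_def inner_A_def by (metis inner_commute)

lemma norm_A_power2:
  assumes "spd_on V A" "subspace V" "x \<in> V"
  shows "(norm_A A x)\<^sup>2 = inner_A A x x"
proof -
  have "0 \<le> inner_A A x x"
    using assms spd_on_zero[OF assms(1,2)]
    by (cases "x = 0") (auto simp: spd_on_def inner_A_def intro: less_imp_le)
  then show ?thesis by (simp add: norm_A_def)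
qed

lemma energy_add:
  assumes "spd_on V A" "subspace V" "x \<in> V" "y \<in> V"
  shows "energy A f (x + y) = energy A f x + (A x - f) \<bullet> y + 1 / 2 * (norm_A A y)\<^sup>2"
proof -
  have "A y \<bullet> x = A x \<bullet> y"
    using inner_A_commute[OF assms(1,3,4)] by (simp add: inner_A_def)
  then show ?thesis
    unfolding energy_def
    by (simp add: norm_A_power2[OF assms(1,2)] assms subspace_add spd_on_add[OF assms(1)]
        inner_A_def inner_add_left inner_add_right inner_diff_left)
qed

text \<open>On the line through \<open>v\<close> in direction \<open>d\<close>, the energy exceeds
  its value at \<open>v\<close> by the quadratic \<open>t * a + 1 / 2 * t\<^sup>2 * q\<close>. Its
  lowest value, at \<open>t = - a / q\<close>, is \<open>- (a\<^sup>2 / (2 * q))\<close>, so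
  minimality forces \<open>a = 0\<close>. Asking for minimality on a single line lets the lemma
  serve both the global and the local problems.\<close>

lemma energy_minimizer_euler:
  assumes A: "spd_on V A" and V: "subspace V" and v: "v \<in> V" and d: "d \<in> V"
    and min: "\<And>t. energy A f v \<le> energy A f (v + t *\<^sub>R d)"
  shows "(A v - f) \<bullet> d = 0"
proof (cases "d = 0")
  case False
  define a q where "a = (A v - f) \<bullet> d" and "q = inner_A A d d"
  have q: "q > 0" using A d False unfolding spd_on_def inner_A_def q_def by blast
  have nonneg: "0 \<le> t * a + 1 / 2 * t\<^sup>2 * q" for t
    using min[of t] energy_add[OF A V v subspace_scale[OF V d], of f t]
      norm_A_power2[OF A V subspace_scale[OF V d], of t]
    by (simp add: a_def q_def inner_A_def spd_on_scale[OF A d] power2_eq_square)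
  have "(- a / q) * a + 1 / 2 * (- a / q)\<^sup>2 * q = - (a\<^sup>2 / (2 * q))"
    using q by (simp add: field_simps power2_eq_square)
  with nonneg[of "- a / q"] have "a\<^sup>2 / (2 * q) \<le> 0" by linarith
  with q have "a = 0" by (auto simp: divide_le_0_iff)
  then show ?thesis by (simp add: a_def)
qed simp

text \<open>The Euler equation removes the linear term from the expansion of
  \<open>energy A f\<close> about \<open>u\<close>, leaving only the quadratic one.\<close>

lemma energy_diff_minimizer:
  assumes A: "spd_on V A" and V: "subspace V" and K: "subspace K" "K \<subseteq> V"
    and u: "is_arg_min (energy A f) (\<lambda>v. v \<in> K) u"
  shows "d \<in> K \<Longrightarrow> (A u - f) \<bullet> d = 0"
    and "w \<in> K \<Longrightarrow> energy A f w - energy A f u = 1 / 2 * (norm_A A (w - u))\<^sup>2"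
proof -
  have uK: "u \<in> K" and min: "\<And>w. w \<in> K \<Longrightarrow> energy A f u \<le> energy A f w"
    using u by (auto simp: is_arg_min_linorder)
  show euler: "(A u - f) \<bullet> d = 0" if "d \<in> K" for d
    using that K uK by (intro energy_minimizer_euler[OF A V] min)
      (auto intro: subspace_add subspace_scale)
  show "energy A f w - energy A f u = 1 / 2 * (norm_A A (w - u))\<^sup>2" if "w \<in> K"
  proof -
    have d: "w - u \<in> K" using that uK K by (simp add: subspace_diff)
    then have "u \<in> V" "w - u \<in> V" using uK K by auto
    with energy_add[OF A V, of u "w - u" f] euler[OF d] show ?thesis by simp
  qed
qed

text \<open>Used with \<open>X\<close> the old and \<open>Y\<close> the new energy error, so
  \<open>X - Y\<close> is the decrease over the sweep. Collecting \<open>Y\<close> gives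
  \<open>(1 + C) * Y \<le> C * X\<close>.\<close>

lemma contraction_factor:
  fixes X Y C :: real
  assumes "0 < C" "Y \<le> C * (X - Y)"
  shows "Y \<le> (1 - 1 / (1 + C)) * X"
proof -
  have "1 - 1 / (1 + C) = C / (1 + C)" using assms by (simp add: field_simps)
  then show ?thesis using assms by (simp add: field_simps)
qed

theorem theorem4p7:
  fixes V :: "'h::{real_inner, complete_space} set"
    and A :: "'h \<Rightarrow> 'h"
    and B :: "'h \<Rightarrow> 'p::{real_inner, complete_space}"
    and f :: 'h
    and N :: nat
    and Vi Ki :: "nat \<Rightarrow> 'h set"
    and K :: "'h set"
    and E :: "'h \<Rightarrow> real"
    and C\<^sub>A C\<^sub>S :: real
    and u u\<^sub>k :: 'h
  assumes "subspace V" and "closed V"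
    and "spd_on V A"
    and "bounded_linear_on_subspace V B"
    and K: "K = ker_on V B"
    and E: "E = energy A f"
    and "N \<ge> 1"
    and "\<And>i. i \<in> {1..N} \<Longrightarrow> subspace (Vi i) \<and> Vi i \<subseteq> V"
    and "V = (\<Sum>i=1..N. Vi i)"
    and Ki: "\<And>i. i \<in> {1..N} \<Longrightarrow> Ki i = Vi i \<inter> ker_on V B"
    and "K = (\<Sum>i=1..N. Ki i)"
    and "saddle_point_well_posed V A B"
    and "\<exists>!v. is_arg_min E (\<lambda>v. v \<in> K) v"
    and "\<And>i w. i \<in> {1..N} \<Longrightarrow> w \<in> K \<Longrightarrow> \<exists>!e. is_arg_min (\<lambda>e. E (w + e)) (\<lambda>e. e \<in> Ki i) e"
    and "C\<^sub>A > 0" and "C\<^sub>S > 0"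
    and SD: "stable_decomposition A K Ki N C\<^sub>A"
    and SCS: "strengthened_cauchy_schwarz A Ki N C\<^sub>S"
    and "is_arg_min E (\<lambda>v. v \<in> K) u"
    and "u\<^sub>k \<in> K"
  shows "E (SSO E Ki N u\<^sub>k) - E u \<le> (1 - 1 / (1 + C\<^sub>A * C\<^sub>S)) * (E u\<^sub>k - E u)"
proof -
  note V = \<open>subspace V\<close> and A = \<open>spd_on V A\<close>
  define v where "v = sso_iterate E Ki u\<^sub>k"
  define e where "e i = v i - v (i - 1)" for i
  have K_sub: "subspace K" "K \<subseteq> V"
    using assms subspace_ker_on[of V B]
    by (auto simp: bounded_linear_on_subspace_def ker_on_def)
  have Ki_sub: "subspace (Ki i)" "Ki i \<subseteq> K" if "i \<in> {1..N}" for i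
    using assms(8)[OF that] Ki[OF that] K K_sub by (auto intro: subspace_inter)
  \<comment> \<open>Local minimizers are only assumed to exist at points of \<open>K\<close>, hence
    the premise \<open>v i \<in> K\<close>. The induction for \<open>vK\<close> supplies it one step
    at a time.\<close>
  have step: "is_arg_min (\<lambda>e. E (v i + e)) (\<lambda>e. e \<in> Ki (Suc i)) (e (Suc i))"
    if "i < N" "v i \<in> K" for i
  proof -
    have "\<exists>e. is_arg_min (\<lambda>e. E (v i + e)) (\<lambda>e. e \<in> Ki (Suc i)) e"
      using assms(14)[of "Suc i" "v i"] that by auto
    then show ?thesis
      unfolding e_def v_def by (simp add: arg_min_on_def arg_min_def someI_ex)
  qed
  have vK: "v i \<in> K" if "i \<le> N" for i
    using that
  proof (induction i)
    case (Suc i)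
    then have "e (Suc i) \<in> Ki (Suc i)" using step[of i] by (simp add: is_arg_min_def)
    then have "v i + e (Suc i) \<in> K"
      using Suc Ki_sub[of "Suc i"] K_sub by (auto intro: subspace_add)
    then show ?case by (simp add: e_def)
  qed (simp add: v_def \<open>u\<^sub>k \<in> K\<close>)
  have vV: "v i \<in> V" if "i \<le> N" for i
    using vK[OF that] K_sub by auto
  have eKi: "e i \<in> Ki i" if "i \<in> {1..N}" for i
    using step[of "i - 1"] vK[of "i - 1"] that by (auto simp: is_arg_min_def)
  have eV: "e i \<in> V" if "i \<in> {1..N}" for i
    using eKi[OF that] Ki_sub[OF that] K_sub by auto
  have local_euler: "(A (v i) - f) \<bullet> d = 0" if i: "i \<in> {1..N}" and d: "d \<in> Ki i" for i d
  proof (rule energy_minimizer_euler[OF A V])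
    show "v i \<in> V" "d \<in> V" using vV[of i] Ki_sub[OF i] K_sub i d by auto
    fix t
    \<comment> \<open>Since \<open>v i = v (i - 1) + e i\<close>, moving \<open>v i\<close> by a
      multiple of \<open>d\<close> means replacing \<open>e i\<close> by another competitor in the
      same local problem.\<close>
    have "e i + t *\<^sub>R d \<in> Ki i"
      using eKi Ki_sub i d by (simp add: subspace_add subspace_scale)
    then have "E (v (i - 1) + e i) \<le> E (v (i - 1) + (e i + t *\<^sub>R d))"
      using step[of "i - 1"] vK[of "i - 1"] i by (auto simp: is_arg_min_linorder)
    then show "energy A f (v i) \<le> energy A f (v i + t *\<^sub>R d)"
      by (simp add: E e_def add.assoc[symmetric])
  qed

  define S where "S = (\<Sum>i=1..N. (norm_A A (e i))\<^sup>2)"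
  have S_nonneg: "0 \<le> S" by (simp add: S_def sum_nonneg)
  have decrease: "E (v (i - 1)) - E (v i) = 1 / 2 * (norm_A A (e i))\<^sup>2" if i: "i \<in> {1..N}" for i
  proof -
    \<comment> \<open>The expansion runs backwards, from \<open>v i\<close> to
      \<open>v (i - 1)\<close>, because the Euler equation holds at the corrected iterate.\<close>
    have "- e i \<in> V" by (rule subspace_neg[OF V eV[OF i]])
    moreover have vi: "v i \<in> V" "v (i - 1) = v i + - e i"
      using vV[of i] i by (simp_all add: e_def)
    moreover have "norm_A A (- e i) = norm_A A (e i)"
      using spd_on_scale[OF A eV[OF i], of "- 1"] by (simp add: norm_A_def inner_A_def)
    ultimately show ?thesis
      using energy_add[OF A V vi(1) \<open>- e i \<in> V\<close>, of f] local_euler[OF i eKi[OF i]]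
      by (simp add: E)
  qed
  have "E (v 0) - E (v n) = 1 / 2 * (\<Sum>i=1..n. (norm_A A (e i))\<^sup>2)" if "n \<le> N" for n
    using that
  proof (induction n)
    case (Suc n)
    then show ?case using decrease[of "Suc n"] by (simp add: algebra_simps)
  qed simp
  from this[of N] have total: "E u\<^sub>k - E (v N) = 1 / 2 * S"
    by (simp add: S_def v_def)

  note diff_minimizer = energy_diff_minimizer[OF A V K_sub \<open>is_arg_min E (\<lambda>v. v \<in> K) u\<close>[unfolded E]]
  have uK: "u \<in> K" using assms(19) by (simp add: is_arg_min_def)
  then have uV: "u \<in> V" using K_sub by auto
  define d where "d = v N - u"
  have dK: "d \<in> K" using vK[of N] uK K_sub by (simp add: d_def subspace_diff)
  then have dV: "d \<in> V" using K_sub by auto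
  from SD dK obtain w where w: "\<And>i. i \<in> {1..N} \<Longrightarrow> w i \<in> Ki i" "d = (\<Sum>i=1..N. w i)"
    and w_le: "(\<Sum>i=1..N. (norm_A A (w i))\<^sup>2) \<le> C\<^sub>A * (norm_A A d)\<^sup>2"
    unfolding stable_decomposition_def by blast
  have wV: "w i \<in> V" if "i \<in> {1..N}" for i
    using w(1)[OF that] Ki_sub[OF that] K_sub by auto
  have telescope: "v N - v i = (\<Sum>j=i+1..N. e j)" if "i \<le> N" for i
    using sum_telescope''[OF that, of v] by (simp add: e_def atLeastSucAtMost_greaterThanAtMost)
  have error_component: "inner_A A d (w i) = (\<Sum>j=i+1..N. inner_A A (w i) (e j))"
    if i: "i \<in> {1..N}" for i
  proof -
    have "inner_A A d (w i) = (A (v N) - f) \<bullet> w i - (A u - f) \<bullet> w i"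
      using vV[of N] uV by (simp add: d_def inner_A_def spd_on_diff[OF A V] inner_diff_left)
    \<comment> \<open>Both subtracted residuals vanish on \<open>w i\<close>: the one at
      \<open>u\<close> because \<open>w i \<in> K\<close>, the one at \<open>v i\<close> because
      \<open>w i \<in> Ki i\<close>. Exchanging them leaves only the corrections made after step
      \<open>i\<close>, which is the strict upper triangle in (SCS).\<close>
    also have "\<dots> = (A (v N) - f) \<bullet> w i - (A (v i) - f) \<bullet> w i"
      using diff_minimizer(1)[of "w i"] local_euler[OF i w(1)[OF i]] Ki_sub[OF i] w(1)[OF i] by auto
    also have "\<dots> = A (v N - v i) \<bullet> w i"
      using vV[of N] vV[of i] i by (simp add: spd_on_diff[OF A V] inner_diff_left)
    also have "\<dots> = (\<Sum>j=i+1..N. inner_A A (e j) (w i))"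
      using i spd_on_sum[OF A V, of "{i+1..N}" e] eV
      by (simp add: telescope inner_sum_left inner_A_def)
    also have "\<dots> = (\<Sum>j=i+1..N. inner_A A (w i) (e j))"
      using eV wV[OF i] by (intro sum.cong refl inner_A_commute[OF A]) auto
    finally show ?thesis .
  qed
  define D where "D = (norm_A A d)\<^sup>2"
  have D_nonneg: "0 \<le> D" by (simp add: D_def)
  have "D = inner_A A d (\<Sum>i=1..N. w i)"
    using norm_A_power2[OF A V dV] by (simp only: D_def w(2)[symmetric])
  also have "\<dots> = (\<Sum>i=1..N. inner_A A d (w i))"
    by (simp add: inner_A_def inner_sum_right)
  also have "\<dots> = (\<Sum>i=1..N. \<Sum>j=i+1..N. inner_A A (w i) (e j))"
    by (intro sum.cong refl error_component)
  also have "\<dots> \<le> sqrt C\<^sub>S * sqrt (\<Sum>i=1..N. (norm_A A (w i))\<^sup>2) * sqrt S"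
    using SCS w(1) eKi unfolding strengthened_cauchy_schwarz_def S_def by blast
  also have "\<dots> \<le> sqrt C\<^sub>S * sqrt (C\<^sub>A * D) * sqrt S"
    using w_le S_nonneg \<open>C\<^sub>S > 0\<close>
    by (intro mult_right_mono mult_left_mono) (simp_all add: D_def)
  finally have "D \<le> sqrt (C\<^sub>S * (C\<^sub>A * D) * S)" by (simp add: real_sqrt_mult)
  then have "D\<^sup>2 \<le> C\<^sub>S * (C\<^sub>A * D) * S"
    using D_nonneg S_nonneg \<open>C\<^sub>A > 0\<close> \<open>C\<^sub>S > 0\<close> by (simp add: real_le_rsqrt sqrt_ge_absD)
  then have "D * D \<le> D * (C\<^sub>A * C\<^sub>S * S)" by (simp add: power2_eq_square mult_ac)
  \<comment> \<open>Cancelling a factor \<open>D\<close> needs \<open>D > 0\<close>; for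
    \<open>D = 0\<close> the right-hand side is nonnegative anyway.\<close>
  then have D_le: "D \<le> C\<^sub>A * C\<^sub>S * S"
    using D_nonneg S_nonneg \<open>C\<^sub>A > 0\<close> \<open>C\<^sub>S > 0\<close>
    by (cases "D = 0") (auto simp: mult_le_cancel_left)
  have "E (v N) - E u = 1 / 2 * D"
    using diff_minimizer(2)[of "v N"] vK[of N] by (simp add: D_def d_def E)
  \<comment> \<open>The bracket equals \<open>E u\<^sub>k - E (v N) = 1 / 2 * S\<close>, so the
    halves on both sides of \<open>D_le\<close> match.\<close>
  then have "E (v N) - E u \<le> C\<^sub>A * C\<^sub>S * ((E u\<^sub>k - E u) - (E (v N) - E u))"
    using D_le by (simp add: total)
  then show ?thesis
    using \<open>C\<^sub>A > 0\<close> \<open>C\<^sub>S > 0\<close> by (intro contraction_factor) (simp_all add: SSO_def v_def)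
qed

end
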